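(* Let $\epsilon\ge 0$ be a real number. Every Lebesgue measurable subset of $[0,1]$ with Lebesgue measure $\epsilon$ contains a (Lebesgue measurable) centrally symmetric subset with measure $0.631\,\epsilon^2$.
   Context: A set $S\subseteq\mathbb{R}$ is centrally symmetric if there is a real number $c$ such that $S=c-S$, where $c-S=\{c-s\colon s\in S\}$. *)

theory Defs
  imports "HOL-Analysis.Analysis"
begin

definition centrally_symmetric :: "real set \<Rightarrow> bool" where
  "centrally_symmetric S \<longleftrightarrow> (\<exists>c. S = (\<lambda>s. c - s) ` S)"

end

theory Submission
  imports Defs
begin

text \<open>
  After rescaling, one has to show that a density \<open>f\<close> on an interval of length \<open>21\<close> has an
  autoconvolution \<open>f * f\<close> exceeding \<open>M = 0.631 / 21\<close> somewhere; the point where this happens is a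
  centre of symmetry, and the symmetric set found there is shrunk continuously to the right measure.

  Write \<open>r\<close> for the autocorrelation of \<open>f\<close> and test against the autocorrelation \<open>K\<close> of a fixed
  nonnegative step function \<open>\<phi>\<close>. If \<open>f * f \<le> M\<close>, then \<open>r\<close> and \<open>f * f\<close> have the same \<open>L\<^sup>2\<close> norm,
  which is at most \<open>sqrt M\<close>, so Cauchy--Schwarz on the support \<open>[-21, 21]\<close> of \<open>r\<close> bounds
  \<open>\<integral> r K\<close> from above. The sum of \<open>\<integral> r K\<close> and the integral of the (centred) function \<open>f * f\<close> against
  \<open>K\<close> is half of the squared \<open>L\<^sup>2\<close> norm of \<open>F * \<phi>\<close>, where \<open>F\<close> is twice the symmetrization of \<open>f\<close>.
  This norm is bounded from below by pairing \<open>F * \<phi>\<close> with a second step function \<open>\<psi>\<close> whose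
  correlation with \<open>\<phi>\<close> is bounded below on \<open>[0, 21]\<close>. The two bounds are incompatible. This is the
  method of Martin and O'Bryant, with step functions in place of Fourier series.
\<close>

subsection \<open>Convolution and correlation\<close>

text \<open>With values in \<open>ennreal\<close> both integrals exist without integrability
  hypotheses; the price is that inequalities between them are kept free of subtraction.\<close>

definition conv :: "(real \<Rightarrow> ennreal) \<Rightarrow> (real \<Rightarrow> ennreal) \<Rightarrow> real \<Rightarrow> ennreal" where
  "conv f g t = (\<integral>\<^sup>+x. f x * g (t - x) \<partial>lborel)"

definition corr :: "(real \<Rightarrow> ennreal) \<Rightarrow> (real \<Rightarrow> ennreal) \<Rightarrow> real \<Rightarrow> ennreal" where
  "corr f g t = (\<integral>\<^sup>+x. f x * g (x + t) \<partial>lborel)"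

lemma measurable_conv [measurable]:
  assumes [measurable]: "f \<in> borel_measurable borel" "g \<in> borel_measurable borel"
  shows "conv f g \<in> borel_measurable borel"
  unfolding conv_def by measurable

lemma measurable_corr [measurable]:
  assumes [measurable]: "f \<in> borel_measurable borel" "g \<in> borel_measurable borel"
  shows "corr f g \<in> borel_measurable borel"
  unfolding corr_def by measurable

lemma nn_integral_lborel_shift:
  fixes f :: "real \<Rightarrow> ennreal"
  assumes "f \<in> borel_measurable borel"
  shows "(\<integral>\<^sup>+x. f (x + c) \<partial>lborel) = (\<integral>\<^sup>+x. f x \<partial>lborel)"
  using nn_integral_real_affine[OF assms, of 1 c] by (simp add: add.commute)

lemma nn_integral_lborel_reflect:
  fixes f :: "real \<Rightarrow> ennreal"
  assumes "f \<in> borel_measurable borel"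
  shows "(\<integral>\<^sup>+x. f (c - x) \<partial>lborel) = (\<integral>\<^sup>+x. f x \<partial>lborel)"
  using nn_integral_real_affine[OF assms, of "-1" c] by simp

lemma nn_integral_lborel_swap:
  fixes f :: "real \<Rightarrow> real \<Rightarrow> ennreal"
  assumes [measurable]: "case_prod f \<in> borel_measurable (borel \<Otimes>\<^sub>M borel)"
  shows "(\<integral>\<^sup>+x. \<integral>\<^sup>+y. f x y \<partial>lborel \<partial>lborel) = (\<integral>\<^sup>+y. \<integral>\<^sup>+x. f x y \<partial>lborel \<partial>lborel)"
  by (rule lborel_pair.Fubini'[symmetric]) measurable

lemma nn_integral_corr:
  assumes [measurable]: "f \<in> borel_measurable borel" "g \<in> borel_measurable borel"
  shows "(\<integral>\<^sup>+t. corr f g t \<partial>lborel) = (\<integral>\<^sup>+x. f x \<partial>lborel) * (\<integral>\<^sup>+x. g x \<partial>lborel)"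
proof -
  have "(\<integral>\<^sup>+t. corr f g t \<partial>lborel) = (\<integral>\<^sup>+x. \<integral>\<^sup>+t. f x * g (t + x) \<partial>lborel \<partial>lborel)"
    unfolding corr_def by (subst nn_integral_lborel_swap) (simp_all add: add.commute)
  also have "\<dots> = (\<integral>\<^sup>+x. f x * (\<integral>\<^sup>+t. g (t + x) \<partial>lborel) \<partial>lborel)"
    by (intro nn_integral_cong nn_integral_cmult) measurable
  also have "\<dots> = (\<integral>\<^sup>+x. f x * (\<integral>\<^sup>+t. g t \<partial>lborel) \<partial>lborel)"
    by (simp add: nn_integral_lborel_shift)
  finally show ?thesis by (simp add: nn_integral_multc)
qed

text \<open>By Tonelli, the adjoint of convolution with \<open>g\<close> is correlation with
  \<open>g\<close>.\<close>

lemma nn_integral_conv_mult: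
  assumes [measurable]: "f \<in> borel_measurable borel" "g \<in> borel_measurable borel" "h \<in> borel_measurable borel"
  shows "(\<integral>\<^sup>+z. conv f g z * h z \<partial>lborel) = (\<integral>\<^sup>+x. f x * corr g h x \<partial>lborel)"
proof -
  have "(\<integral>\<^sup>+z. conv f g z * h z \<partial>lborel) = (\<integral>\<^sup>+z. \<integral>\<^sup>+x. f x * (g (z - x) * h z) \<partial>lborel \<partial>lborel)"
    unfolding conv_def by (simp add: nn_integral_multc[symmetric] mult.assoc)
  also have "\<dots> = (\<integral>\<^sup>+x. \<integral>\<^sup>+z. f x * (g (z - x) * h z) \<partial>lborel \<partial>lborel)"
    by (rule nn_integral_lborel_swap) measurable
  also have "\<dots> = (\<integral>\<^sup>+x. f x * (\<integral>\<^sup>+z. g (z - x) * h z \<partial>lborel) \<partial>lborel)"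
    by (intro nn_integral_cong nn_integral_cmult) measurable
  also have "\<dots> = (\<integral>\<^sup>+x. f x * corr g h x \<partial>lborel)"
  proof (intro nn_integral_cong arg_cong2[where f = "(*)"] refl)
    fix x
    show "(\<integral>\<^sup>+z. g (z - x) * h z \<partial>lborel) = corr g h x"
      using nn_integral_lborel_shift[of "\<lambda>z. g (z - x) * h z" x] unfolding corr_def by simp
  qed
  finally show ?thesis .
qed

lemma nn_integral_corr_mult:
  assumes [measurable]: "f \<in> borel_measurable borel" "g \<in> borel_measurable borel" "h \<in> borel_measurable borel"
  shows "(\<integral>\<^sup>+t. corr f g t * h t \<partial>lborel) = (\<integral>\<^sup>+x. \<integral>\<^sup>+y. f x * g y * h (y - x) \<partial>lborel \<partial>lborel)"
proof -
  have "(\<integral>\<^sup>+t. corr f g t * h t \<partial>lborel) = (\<integral>\<^sup>+t. \<integral>\<^sup>+x. f x * g (x + t) * h t \<partial>lborel \<partial>lborel)"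
    unfolding corr_def by (simp add: nn_integral_multc)
  also have "\<dots> = (\<integral>\<^sup>+x. \<integral>\<^sup>+t. f x * g (x + t) * h t \<partial>lborel \<partial>lborel)"
    by (rule nn_integral_lborel_swap) measurable
  also have "\<dots> = (\<integral>\<^sup>+x. \<integral>\<^sup>+y. f x * g y * h (y - x) \<partial>lborel \<partial>lborel)"
  proof (rule nn_integral_cong)
    fix x
    show "(\<integral>\<^sup>+t. f x * g (x + t) * h t \<partial>lborel) = (\<integral>\<^sup>+y. f x * g y * h (y - x) \<partial>lborel)"
      using nn_integral_lborel_shift[of "\<lambda>y. f x * g y * h (y - x)" x] by (simp add: add.commute)
  qed
  finally show ?thesis .
qed

text \<open>Both sides are the double integral of \<open>f x * f y * corr g g (x - y)\<close>. For
  \<open>g = f\<close> this compares the norms of \<open>conv f f\<close> and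
  \<open>corr f f\<close>; for \<open>g = \<phi>\<close> it turns the integral of an autocorrelation
  against the kernel into a squared norm.\<close>

lemma nn_integral_conv_square:
  assumes [measurable]: "f \<in> borel_measurable borel" "g \<in> borel_measurable borel"
  shows "(\<integral>\<^sup>+z. conv f g z * conv f g z \<partial>lborel) = (\<integral>\<^sup>+t. corr f f t * corr g g t \<partial>lborel)"
proof -
  have "(\<integral>\<^sup>+z. conv f g z * conv f g z \<partial>lborel) = (\<integral>\<^sup>+x. f x * corr g (conv f g) x \<partial>lborel)"
    by (rule nn_integral_conv_mult) measurable
  also have "\<dots> = (\<integral>\<^sup>+x. \<integral>\<^sup>+y. f x * f y * corr g g (x - y) \<partial>lborel \<partial>lborel)"
  proof (rule nn_integral_cong)
    fix x
    have "corr g (conv f g) x = (\<integral>\<^sup>+z. conv f g z * g (z - x) \<partial>lborel)"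
      using nn_integral_lborel_shift[of "\<lambda>z. conv f g z * g (z - x)" x] by (simp add: corr_def mult.commute)
    also have "\<dots> = (\<integral>\<^sup>+y. f y * corr g (\<lambda>z. g (z - x)) y \<partial>lborel)"
      by (rule nn_integral_conv_mult) measurable
    also have "\<dots> = (\<integral>\<^sup>+y. f y * corr g g (x - y) \<partial>lborel)"
    proof (intro nn_integral_cong arg_cong2[where f = "(*)"] refl)
      fix y
      show "corr g (\<lambda>z. g (z - x)) y = corr g g (x - y)"
        using nn_integral_lborel_shift[of "\<lambda>z. g z * g (z + y - x)" "x - y"]
        by (simp add: corr_def mult.commute add.commute add.left_commute algebra_simps)
    qed
    finally show "f x * corr g (conv f g) x = (\<integral>\<^sup>+y. f x * f y * corr g g (x - y) \<partial>lborel)"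
      by (simp add: nn_integral_cmult mult.assoc)
  qed
  also have "\<dots> = (\<integral>\<^sup>+y. \<integral>\<^sup>+x. f y * f x * corr g g (x - y) \<partial>lborel \<partial>lborel)"
    by (subst nn_integral_lborel_swap) (simp_all add: mult.commute)
  finally show ?thesis by (simp add: nn_integral_corr_mult)
qed

lemma corr_uminus:
  assumes [measurable]: "f \<in> borel_measurable borel"
  shows "corr f f (- t) = corr f f t"
  using nn_integral_lborel_shift[of "\<lambda>x. f x * f (x - t)" t]
  by (simp add: corr_def mult.commute)

text \<open>Of the four products in the expansion, the two with equal orientation give the
  autocorrelation of \<open>f\<close>, and the two mixed ones give its autoconvolution at
  \<open>c + t\<close> and \<open>c - t\<close>.\<close>

lemma corr_symmetrization:
  fixes c t :: real
  assumes [measurable]: "f \<in> borel_measurable borel"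
  defines "g \<equiv> \<lambda>x. f x + f (c - x)"
  shows "corr g g t = 2 * corr f f t + (conv f f (c + t) + conv f f (c - t))"
proof -
  have 0: "(\<integral>\<^sup>+x. f x * f (x + t) \<partial>lborel) = corr f f t"
    by (simp add: corr_def)
  have 1: "(\<integral>\<^sup>+x. f (c - x) * f (c - (x + t)) \<partial>lborel) = corr f f t"
    using nn_integral_lborel_reflect[of "\<lambda>x. f x * f (x - t)" c] corr_uminus[of f t]
    by (simp add: corr_def algebra_simps)
  have 2: "(\<integral>\<^sup>+x. f (c - x) * f (x + t) \<partial>lborel) = conv f f (c + t)"
    using nn_integral_lborel_reflect[of "\<lambda>x. f x * f (c + t - x)" c]
    by (simp add: conv_def algebra_simps)
  have 3: "(\<integral>\<^sup>+x. f x * f (c - (x + t)) \<partial>lborel) = conv f f (c - t)"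
    by (simp add: conv_def algebra_simps)
  have "corr g g t = (\<integral>\<^sup>+x. f x * f (x + t) + f x * f (c - (x + t))
        + (f (c - x) * f (x + t) + f (c - x) * f (c - (x + t))) \<partial>lborel)"
    by (simp add: corr_def g_def distrib_left distrib_right add_ac)
  also have "\<dots> = (corr f f t + conv f f (c - t)) + (conv f f (c + t) + corr f f t)"
    using 0 1 2 3 by (simp add: nn_integral_add)
  finally show ?thesis by (simp add: mult_2 add_ac)
qed

subsection \<open>Step functions on the unit grid\<close>

text \<open>Natural number weights keep the numerical sums exact.\<close>

definition step :: "(int \<Rightarrow> nat) \<Rightarrow> real \<Rightarrow> ennreal" where
  "step w x = of_nat (w \<lfloor>x\<rfloor>)"

lemma measurable_step [measurable]: "step w \<in> borel_measurable borel"
  unfolding step_def by measurable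

lemma nn_integral_lborel_unit_cells:
  fixes f :: "real \<Rightarrow> ennreal" and a b :: int
  assumes [measurable]: "f \<in> borel_measurable borel"
    and zero: "\<And>x. \<lfloor>x\<rfloor> \<notin> {a..<b} \<Longrightarrow> f x = 0"
  shows "(\<integral>\<^sup>+x. f x \<partial>lborel) = (\<Sum>k\<in>{a..<b}. \<integral>\<^sup>+s. f (of_int k + s) * indicator {0..<1} s \<partial>lborel)"
proof -
  have "f x = (\<Sum>k\<in>{a..<b}. f x * indicator {of_int k..<of_int k + 1} x)" for x
  proof (cases "\<lfloor>x\<rfloor> \<in> {a..<b}")
    case True
    have "(\<Sum>k\<in>{a..<b}. f x * indicator {of_int k..<of_int k + 1} x) = (\<Sum>k\<in>{\<lfloor>x\<rfloor>}. f x * indicator {of_int k..<of_int k + 1} x)"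
      using True by (intro sum.mono_neutral_right) (auto simp: indicator_def floor_eq_iff eq_commute[of _ "\<lfloor>x\<rfloor>"])
    also have "\<dots> = f x"
      by (simp add: indicator_def)
    finally show ?thesis by simp
  qed (simp add: zero)
  then have "(\<integral>\<^sup>+x. f x \<partial>lborel) = (\<integral>\<^sup>+x. (\<Sum>k\<in>{a..<b}. f x * indicator {of_int k..<of_int k + 1} x) \<partial>lborel)"
    by presburger
  also have "\<dots> = (\<Sum>k\<in>{a..<b}. \<integral>\<^sup>+x. f x * indicator {of_int k..<of_int k + 1} x \<partial>lborel)"
    by (rule nn_integral_sum) measurable
  also have "\<dots> = (\<Sum>k\<in>{a..<b}. \<integral>\<^sup>+s. f (of_int k + s) * indicator {0..<1} s \<partial>lborel)"
  proof (rule sum.cong[OF refl])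
    fix k :: int
    have *: "indicator {of_int k..<of_int k + 1} (s + of_int k) = (indicator {0..<1} s :: ennreal)" for s :: real
      by (auto simp: indicator_def)
    show "(\<integral>\<^sup>+x. f x * indicator {of_int k..<of_int k + 1} x \<partial>lborel) = (\<integral>\<^sup>+s. f (of_int k + s) * indicator {0..<1} s \<partial>lborel)"
      using nn_integral_lborel_shift[of "\<lambda>x. f x * indicator {of_int k..<of_int k + 1} x" "of_int k"]
      unfolding * by (simp add: add.commute)
  qed
  finally show ?thesis .
qed

text \<open>The grid point \<open>k + 1\<close> is reached at \<open>z = 1 - s\<close>, which cuts
  the unit interval into pieces of lengths \<open>1 - s\<close> and \<open>s\<close>.\<close>

lemma nn_integral_step_cell:
  assumes "0 \<le> s" "s < 1"
  shows "(\<integral>\<^sup>+z. step v (of_int k + s + z) * indicator {0..<1} z \<partial>lborel)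
    = ennreal (1 - s) * of_nat (v k) + ennreal s * of_nat (v (k + 1))"
proof -
  have "step v (of_int k + s + z) * indicator {0..<1} z
      = of_nat (v k) * indicator {0..<1 - s} z + of_nat (v (k + 1)) * indicator {1 - s..<1} z" for z
  proof (cases "z \<in> {0..<1}")
    case True
    then have "\<lfloor>of_int k + s + z\<rfloor> = (if z < 1 - s then k else k + 1)"
      using assms by (auto simp: floor_eq_iff)
    then show ?thesis using True assms by (auto simp: step_def indicator_def)
  qed (use assms in \<open>auto simp: indicator_def\<close>)
  then have "(\<integral>\<^sup>+z. step v (of_int k + s + z) * indicator {0..<1} z \<partial>lborel)
     = (\<integral>\<^sup>+z. of_nat (v k) * indicator {0..<1 - s} z + of_nat (v (k + 1)) * indicator {1 - s..<1} z \<partial>lborel)"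
    by presburger
  also have "\<dots> = ennreal (1 - s) * of_nat (v k) + ennreal s * of_nat (v (k + 1))"
    using assms by (simp add: nn_integral_add nn_integral_cmult_indicator mult.commute)
  finally show ?thesis .
qed

lemma nn_integral_step:
  assumes "\<And>i. i \<notin> {a..<b} \<Longrightarrow> w i = 0"
  shows "(\<integral>\<^sup>+x. step w x \<partial>lborel) = of_nat (\<Sum>i\<in>{a..<b}. w i)"
proof -
  have "(\<integral>\<^sup>+x. step w x \<partial>lborel) = (\<Sum>i\<in>{a..<b}. \<integral>\<^sup>+s. step w (of_int i + s) * indicator {0..<1} s \<partial>lborel)"
    using assms by (intro nn_integral_lborel_unit_cells) (auto simp: step_def)
  also have "\<dots> = (\<Sum>i\<in>{a..<b}. of_nat (w i))"
    using nn_integral_step_cell[of 0 w] by simp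
  finally show ?thesis by simp
qed

text \<open>Each cell contributes a linear interpolation, so between integers the correlation of
  step functions interpolates linearly the discrete correlation of their weights.\<close>

lemma corr_step:
  fixes k :: int and w v :: "int \<Rightarrow> nat"
  assumes w: "\<And>i. i \<notin> {a..<b} \<Longrightarrow> w i = 0" and s: "0 \<le> s" "s < 1"
  shows "corr (step w) (step v) (of_int k + s)
    = ennreal (1 - s) * of_nat (\<Sum>i\<in>{a..<b}. w i * v (i + k))
      + ennreal s * of_nat (\<Sum>i\<in>{a..<b}. w i * v (i + (k + 1)))"
proof -
  have "corr (step w) (step v) (of_int k + s) = (\<Sum>i\<in>{a..<b}.
      \<integral>\<^sup>+z. step w (of_int i + z) * step v (of_int i + z + (of_int k + s)) * indicator {0..<1} z \<partial>lborel)"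
    unfolding corr_def using w by (intro nn_integral_lborel_unit_cells) (auto simp: step_def)
  also have "\<dots> = (\<Sum>i\<in>{a..<b}. of_nat (w i) *
      (\<integral>\<^sup>+z. step v (of_int (i + k) + s + z) * indicator {0..<1} z \<partial>lborel))"
  proof (rule sum.cong[OF refl])
    fix i :: int
    have "step w (of_int i + z) * step v (of_int i + z + (of_int k + s)) * indicator {0..<1} z
       = of_nat (w i) * (step v (of_int (i + k) + s + z) * indicator {0..<1} z)" for z
    proof (cases "z \<in> {0..<1}")
      case True
      then have "\<lfloor>of_int i + z\<rfloor> = i" by (auto simp: floor_eq_iff)
      then show ?thesis using True by (simp add: step_def add_ac)
    qed simp
    then show "(\<integral>\<^sup>+z. step w (of_int i + z) * step v (of_int i + z + (of_int k + s)) * indicator {0..<1} z \<partial>lborel)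
        = of_nat (w i) * (\<integral>\<^sup>+z. step v (of_int (i + k) + s + z) * indicator {0..<1} z \<partial>lborel)"
      by (simp add: nn_integral_cmult)
  qed
  also have "\<dots> = (\<Sum>i\<in>{a..<b}. of_nat (w i) * (ennreal (1 - s) * of_nat (v (i + k)) + ennreal s * of_nat (v (i + (k + 1)))))"
    by (simp only: nn_integral_step_cell[OF s]) (simp only: add.assoc)
  also have "\<dots> = ennreal (1 - s) * of_nat (\<Sum>i\<in>{a..<b}. w i * v (i + k))
      + ennreal s * of_nat (\<Sum>i\<in>{a..<b}. w i * v (i + (k + 1)))"
    by (simp add: distrib_left sum.distrib sum_distrib_left mult_ac)
  finally show ?thesis .
qed

lemma nn_integral_linear_square:
  fixes p q :: nat
  shows "(\<integral>\<^sup>+s. (ennreal (1 - s) * of_nat p + ennreal s * of_nat q)\<^sup>2 * indicator {0..<1} s \<partial>lborel)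
     = ennreal ((p\<^sup>2 + p * q + q\<^sup>2) / 3)"
proof -
  \<comment> \<open>Term by term antiderivative of the expanded square
    \<open>((1 - s) * p + s * q)\<^sup>2\<close>.\<close>
  define F where "F s = - (real p)\<^sup>2 * (1 - s)^3 / 3 + real p * q * (s^2 - 2 * s^3 / 3) + (real q)\<^sup>2 * s^3 / 3" for s
  have "(\<integral>\<^sup>+s. (ennreal (1 - s) * of_nat p + ennreal s * of_nat q)\<^sup>2 * indicator {0..<1} s \<partial>lborel)
     = (\<integral>\<^sup>+s. ennreal (((1 - s) * p + s * q)\<^sup>2) * indicator {0..1} s \<partial>lborel)"
  proof (intro nn_integral_cong_AE)
    have "AE s in lborel. s \<noteq> (1::real)" by (rule AE_lborel_singleton)
    then show "AE s in lborel. (ennreal (1 - s) * of_nat p + ennreal s * of_nat q)\<^sup>2 * indicator {0..<1} s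
       = ennreal (((1 - s) * p + s * q)\<^sup>2) * indicator {0..1} s"
      by (auto elim!: eventually_mono simp: indicator_def ennreal_of_nat_eq_real_of_nat
          ennreal_mult[symmetric] ennreal_plus[symmetric] ennreal_power simp del: ennreal_plus)
  qed
  also have "\<dots> = ennreal (F 1 - F 0)"
  proof (rule nn_integral_FTC_Icc)
    fix s :: real
    show "(F has_real_derivative ((1 - s) * p + s * q)\<^sup>2) (at s)"
      unfolding F_def
      by (auto intro!: derivative_eq_intros simp: field_simps power2_eq_square)
  qed auto
  also have "F 1 - F 0 = (p\<^sup>2 + p * q + q\<^sup>2) / 3"
    by (simp add: F_def field_simps)
  finally show ?thesis .
qed

lemma nn_integral_corr_step_square:
  fixes w v :: "int \<Rightarrow> nat" and a b c d :: int
  defines "D \<equiv> \<lambda>k. \<Sum>i\<in>{a..<b}. w i * v (i + k)"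
  assumes w: "\<And>i. i \<notin> {a..<b} \<Longrightarrow> w i = 0" and D: "\<And>k. k \<notin> {c<..<d} \<Longrightarrow> D k = 0"
  shows "(\<integral>\<^sup>+t. (corr (step w) (step v) t)\<^sup>2 \<partial>lborel)
    = ennreal (\<Sum>k\<in>{c..<d}. ((D k)\<^sup>2 + D k * D (k + 1) + (D (k + 1))\<^sup>2) / 3)"
proof -
  have cell: "corr (step w) (step v) (of_int k + s) = ennreal (1 - s) * of_nat (D k) + ennreal s * of_nat (D (k + 1))"
    if "0 \<le> s" "s < 1" for k s
    using corr_step[OF w that, where v = v and k = k] by (simp only: D_def)
  \<comment> \<open>Cell \<open>k\<close> involves both \<open>D k\<close> and
    \<open>D (k + 1)\<close>. The cell just left of \<open>c\<close> contributes nothing only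
    because \<open>D\<close> vanishes at \<open>c\<close> itself, hence the open interval in the
    hypothesis.\<close>
  have zero: "corr (step w) (step v) x = 0" if "\<lfloor>x\<rfloor> \<notin> {c..<d}" for x
    using cell[of "frac x" "\<lfloor>x\<rfloor>"] that D[of "\<lfloor>x\<rfloor>"] D[of "\<lfloor>x\<rfloor> + 1"]
    by (auto simp: frac_lt_1) (auto simp: frac_def)
  have "(\<integral>\<^sup>+t. (corr (step w) (step v) t)\<^sup>2 \<partial>lborel)
     = (\<Sum>k\<in>{c..<d}. \<integral>\<^sup>+s. (corr (step w) (step v) (of_int k + s))\<^sup>2 * indicator {0..<1} s \<partial>lborel)"
    by (intro nn_integral_lborel_unit_cells) (auto simp: zero)
  also have "\<dots> = (\<Sum>k\<in>{c..<d}. \<integral>\<^sup>+s. (ennreal (1 - s) * of_nat (D k) + ennreal s * of_nat (D (k + 1)))\<^sup>2 * indicator {0..<1} s \<partial>lborel)"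
    by (intro sum.cong nn_integral_cong refl) (auto simp: cell indicator_def)
  also have "\<dots> = (\<Sum>k\<in>{c..<d}. ennreal (((D k)\<^sup>2 + D k * D (k + 1) + (D (k + 1))\<^sup>2) / 3))"
    by (simp only: nn_integral_linear_square)
  finally show ?thesis by (simp add: sum_ennreal)
qed

text \<open>A linear interpolation stays above a common lower bound of its nodes, so finitely many
  integer shifts have to be checked.\<close>

lemma corr_step_ge:
  fixes w v :: "int \<Rightarrow> nat" and m :: nat
  assumes w: "\<And>i. i \<notin> {a..<b} \<Longrightarrow> w i = 0"
    and ge: "\<And>k. k \<in> {c..d} \<Longrightarrow> m \<le> (\<Sum>i\<in>{a..<b}. w i * v (i + k))"
    and x: "of_int c \<le> x" "x \<le> of_int d"
  shows "of_nat m \<le> corr (step w) (step v) x"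
proof -
  have k: "\<lfloor>x\<rfloor> \<in> {c..d}"
    using x by (auto simp: le_floor_iff floor_le_iff)
  \<comment> \<open>At \<open>x = d\<close> the right node lies outside the checked range, but its
    weight \<open>frac x\<close> is then 0.\<close>
  have k': "\<lfloor>x\<rfloor> + 1 \<in> {c..d}" if "frac x \<noteq> 0"
    using x that k frac_lt_1[of x] unfolding frac_def by auto linarith
  have "(of_nat m :: ennreal) = ennreal ((1 - frac x) * m + frac x * m)"
    by (simp add: ennreal_of_nat_eq_real_of_nat algebra_simps)
  also have "\<dots> = ennreal (1 - frac x) * of_nat m + ennreal (frac x) * of_nat m"
    using frac_lt_1[of x] by (simp add: ennreal_of_nat_eq_real_of_nat ennreal_mult frac_ge_0)
  also have "\<dots> \<le> ennreal (1 - frac x) * of_nat (\<Sum>i = a..<b. w i * v (i + \<lfloor>x\<rfloor>))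
      + ennreal (frac x) * of_nat (\<Sum>i = a..<b. w i * v (i + (\<lfloor>x\<rfloor> + 1)))"
  proof (rule add_mono)
    show "ennreal (1 - frac x) * of_nat m \<le> ennreal (1 - frac x) * of_nat (\<Sum>i = a..<b. w i * v (i + \<lfloor>x\<rfloor>))"
      by (intro mult_left_mono of_nat_mono ge k) auto
    show "ennreal (frac x) * of_nat m \<le> ennreal (frac x) * of_nat (\<Sum>i = a..<b. w i * v (i + (\<lfloor>x\<rfloor> + 1)))"
    proof (cases "frac x = 0")
      case True
      show ?thesis unfolding True by simp
    next
      case False
      show ?thesis by (intro mult_left_mono of_nat_mono ge k' False) auto
    qed
  qed
  also have "\<dots> = corr (step w) (step v) (of_int \<lfloor>x\<rfloor> + frac x)"
    by (rule corr_step[OF w frac_ge_0 frac_lt_1, symmetric])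
  finally show ?thesis by (simp add: frac_def)
qed

subsection \<open>The two bounds\<close>

lemma ennreal_two_mult_le_sum_squares: "2 * (x * y) \<le> x\<^sup>2 + (y\<^sup>2 :: ennreal)"
proof (cases x; cases y)
  fix a b assume "x = ennreal a" "0 \<le> a" "y = ennreal b" "0 \<le> b"
  moreover have "2 * (a * b) \<le> a\<^sup>2 + b\<^sup>2" using sum_squares_bound[of a b] by simp
  ultimately show ?thesis
    by (simp add: ennreal_power ennreal_mult[symmetric] ennreal_plus[symmetric] del: ennreal_plus
        flip: ennreal_numeral)
qed (auto simp: ennreal_top_mult ennreal_mult_top)

lemma nn_integral_conv:
  assumes [measurable]: "f \<in> borel_measurable borel" "g \<in> borel_measurable borel"
  shows "(\<integral>\<^sup>+t. conv f g t \<partial>lborel) = (\<integral>\<^sup>+x. f x \<partial>lborel) * (\<integral>\<^sup>+x. g x \<partial>lborel)"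
  using nn_integral_conv_mult[of f g "\<lambda>_. 1"] by (simp add: corr_def nn_integral_multc)

text \<open>Cauchy--Schwarz without roots or subtraction: on \<open>S\<close> one integrates
  \<open>2 * (r t * u) \<le> (r t)\<^sup>2 + u\<^sup>2\<close> with
  \<open>u = \<alpha> * K t + \<beta>\<close>. The constant \<beta> exploits the known integral of
  \<open>r\<close>; both multipliers stay free for optimization.\<close>

lemma nn_integral_mult_le_Cauchy:
  fixes r K :: "real \<Rightarrow> ennreal"
  assumes [measurable]: "r \<in> borel_measurable borel" "K \<in> borel_measurable borel" "S \<in> sets borel"
    and r: "\<And>t. t \<notin> S \<Longrightarrow> r t = 0"
  shows "2 * \<alpha> * (\<integral>\<^sup>+t. r t * K t \<partial>lborel) + 2 * \<beta> * (\<integral>\<^sup>+t. r t \<partial>lborel)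
    \<le> (\<integral>\<^sup>+t. (r t)\<^sup>2 \<partial>lborel) + \<alpha>\<^sup>2 * (\<integral>\<^sup>+t. (K t)\<^sup>2 \<partial>lborel)
      + 2 * \<alpha> * \<beta> * (\<integral>\<^sup>+t. K t \<partial>lborel) + \<beta>\<^sup>2 * emeasure lborel S"
proof -
  have "2 * \<alpha> * (r t * K t) + 2 * \<beta> * r t
      \<le> (r t)\<^sup>2 + \<alpha>\<^sup>2 * (K t)\<^sup>2 + 2 * \<alpha> * \<beta> * K t + \<beta>\<^sup>2 * indicator S t" for t
  proof (cases "t \<in> S")
    case True
    then show ?thesis using ennreal_two_mult_le_sum_squares[of "r t" "\<alpha> * K t + \<beta>"]
      by (simp add: power2_sum power_mult_distrib distrib_left mult_ac add_ac)
  qed (simp add: r)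
  then have "(\<integral>\<^sup>+t. 2 * \<alpha> * (r t * K t) + 2 * \<beta> * r t \<partial>lborel)
    \<le> (\<integral>\<^sup>+t. (r t)\<^sup>2 + \<alpha>\<^sup>2 * (K t)\<^sup>2 + 2 * \<alpha> * \<beta> * K t + \<beta>\<^sup>2 * indicator S t \<partial>lborel)"
    by (intro nn_integral_mono)
  then show ?thesis
    by (simp add: nn_integral_add nn_integral_cmult)
qed

text \<open>Duality: pairing \<open>conv f \<phi>\<close> with \<psi> gives the integral of
  \<open>f\<close> against \<open>corr \<phi> \<psi>\<close>, which is at least \<open>m\<close>
  wherever \<open>f\<close> is nonzero. Thus \<psi> bounds the norm of \<open>conv f \<phi>\<close>
  from below; the multiplier \<gamma> replaces a division.\<close>

lemma nn_integral_corr_quadratic_ge: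
  assumes [measurable]: "f \<in> borel_measurable borel" "\<phi> \<in> borel_measurable borel" "\<psi> \<in> borel_measurable borel"
    and ge: "\<And>x. f x \<noteq> 0 \<Longrightarrow> m \<le> corr \<phi> \<psi> x"
  shows "2 * \<gamma> * m * (\<integral>\<^sup>+x. f x \<partial>lborel)
    \<le> (\<integral>\<^sup>+t. corr f f t * corr \<phi> \<phi> t \<partial>lborel) + \<gamma>\<^sup>2 * (\<integral>\<^sup>+x. (\<psi> x)\<^sup>2 \<partial>lborel)"
proof -
  have "f x * m \<le> f x * corr \<phi> \<psi> x" for x
    using ge[of x] by (cases "f x = 0") (auto intro: mult_left_mono)
  then have "(\<integral>\<^sup>+x. f x * m \<partial>lborel) \<le> (\<integral>\<^sup>+x. f x * corr \<phi> \<psi> x \<partial>lborel)"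
    by (intro nn_integral_mono)
  then have "2 * \<gamma> * m * (\<integral>\<^sup>+x. f x \<partial>lborel) \<le> 2 * \<gamma> * (\<integral>\<^sup>+x. f x * corr \<phi> \<psi> x \<partial>lborel)"
    by (simp add: nn_integral_multc mult.assoc mult_left_mono mult.commute[of m])
  also have "\<dots> = 2 * \<gamma> * (\<integral>\<^sup>+z. conv f \<phi> z * \<psi> z \<partial>lborel)"
    by (simp add: nn_integral_conv_mult)
  also have "\<dots> = (\<integral>\<^sup>+z. 2 * (conv f \<phi> z * (\<gamma> * \<psi> z)) \<partial>lborel)"
    by (simp add: nn_integral_cmult[symmetric] mult_ac)
  also have "\<dots> \<le> (\<integral>\<^sup>+z. (conv f \<phi> z)\<^sup>2 + (\<gamma> * \<psi> z)\<^sup>2 \<partial>lborel)"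
    by (intro nn_integral_mono ennreal_two_mult_le_sum_squares)
  also have "\<dots> = (\<integral>\<^sup>+t. corr f f t * corr \<phi> \<phi> t \<partial>lborel) + \<gamma>\<^sup>2 * (\<integral>\<^sup>+x. (\<psi> x)\<^sup>2 \<partial>lborel)"
  proof -
    have "(\<integral>\<^sup>+z. (\<gamma> * \<psi> z)\<^sup>2 \<partial>lborel) = \<gamma>\<^sup>2 * (\<integral>\<^sup>+x. (\<psi> x)\<^sup>2 \<partial>lborel)"
      by (simp add: power_mult_distrib nn_integral_cmult)
    moreover have "(\<integral>\<^sup>+z. (conv f \<phi> z)\<^sup>2 \<partial>lborel) = (\<integral>\<^sup>+t. corr f f t * corr \<phi> \<phi> t \<partial>lborel)"
      using nn_integral_conv_square[of f \<phi>] by (simp add: power2_eq_square)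
    ultimately show ?thesis by (simp add: nn_integral_add)
  qed
  finally show ?thesis .
qed

subsection \<open>The numerical certificate\<close>

text \<open>Extension by zero to all integers spares the shifted sums any boundary cases.\<close>

definition entry :: "nat list \<Rightarrow> int \<Rightarrow> nat" where
  "entry xs i = (if 0 \<le> i \<and> i < int (length xs) then xs ! nat i else 0)"

text \<open>
  The values of \<open>\<phi>\<close> and \<open>\<psi>\<close> were found numerically: \<open>\<phi>\<close> approximates the arcsine density, and
  \<open>\<psi>\<close> is, up to rounding, the minimizer of \<open>\<parallel>\<psi>\<parallel>\<close> when its correlation with \<open>\<phi>\<close> is bounded
  below on \<open>[0, 21]\<close>.
\<close>

definition kernel_weights :: "nat list" where
  "kernel_weights = [14, 6, 5, 5, 6, 14]"

definition dual_weights :: "nat list" where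
  "dual_weights = [8960, 9370, 9602, 9997, 10793, 14823, 12163, 11176, 10373, 9506, 8572, 11702, 12337,
    12452, 12337, 11702, 8572, 9506, 10373, 11176, 12163, 14823, 10793, 9997, 9602, 9370, 8960]"

lemma entry_simps [simp]:
  "entry xs 0 = (if xs = [] then 0 else xs ! 0)"
  "entry xs 1 = (if 1 < length xs then xs ! 1 else 0)"
  "entry xs (numeral n) = (if numeral n < length xs then xs ! numeral n else 0)"
  "entry xs (- 1) = 0"
  "entry xs (- numeral n) = 0"
  by (auto simp: entry_def)

lemma sum_int_rec:
  fixes a b :: int
  shows "sum g {a..<b} = (if a < b then g a + sum g {a + 1..<b} else 0)"
proof -
  have "{a..<b} = insert a {a + 1..<b}" if "a < b" using that by auto
  then show ?thesis by simp
qed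

text \<open>One unfolding rule per shape of a literal lower endpoint lets \<open>simp\<close>
  evaluate the certificate sums term by term.\<close>

lemmas sum_int_numeral =
  sum_int_rec[of _ 0 "numeral n" for n] sum_int_rec[of _ 1 "numeral n" for n]
  sum_int_rec[of _ "numeral m" "numeral n" for m n] sum_int_rec[of _ "- 1" "numeral n" for n]
  sum_int_rec[of _ "- numeral m" "numeral n" for m n]

text \<open>Feasibility of \<psi>: the nodes of [0, 21], both ends included, are checked one by one.
  The bound 551924 is attained at \<open>k = 3\<close>.\<close>

lemma dual_weights_correlation_ge:
  assumes "k \<in> {0..21}"
  shows "551924 \<le> (\<Sum>i\<in>{0..<6}. entry kernel_weights i * entry dual_weights (i + k))"
proof -
  have "\<forall>k\<in>{0, 1, 2, 3, 4, 5, 6, 7, 8, 9, 10, 11, 12, 13, 14, 15, 16, 17, 18, 19, 20, 21}.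
      551924 \<le> (\<Sum>i\<in>{0..<6}. entry kernel_weights i * entry dual_weights (i + k))"
    by (simp add: sum_int_numeral kernel_weights_def dual_weights_def)
  moreover have "{0..21::int} = {0, 1, 2, 3, 4, 5, 6, 7, 8, 9, 10, 11, 12, 13, 14, 15, 16, 17, 18, 19, 20, 21}"
    by (auto simp: simp_from_to)
  ultimately show ?thesis using assms by blast
qed

lemma dual_weights_squares: "(\<Sum>i\<in>{0..<27}. (entry dual_weights i)\<^sup>2) = 3214751020"
  by (simp add: sum_int_numeral dual_weights_def)

lemma kernel_weights_sum: "(\<Sum>i\<in>{0..<6}. entry kernel_weights i) = 50"
  by (simp add: sum_int_numeral kernel_weights_def)

text \<open>By \<open>nn_integral_corr_step_square\<close> this is the integral of the squared
  kernel. \<open>D\<close> vanishes at -6 and 6, so the cells starting at -6 to 5 cover the support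
  of its interpolation.\<close>

lemma kernel_autocorrelation:
  fixes D
  defines "D \<equiv> \<lambda>k. \<Sum>i\<in>{0..<6}. entry kernel_weights i * entry kernel_weights (i + k)"
  shows "(\<Sum>k\<in>{- 6..<6}. ((D k)\<^sup>2 + D k * D (k + 1) + (D (k + 1))\<^sup>2) / 3) = 1891568 / (3::real)"
  by (simp add: sum_int_numeral kernel_weights_def D_def)

lemma entry_eq_0: "i \<notin> {0..<int (length xs)} \<Longrightarrow> entry xs i = 0"
  by (auto simp: entry_def)

lemma corr_eq_0:
  assumes f: "\<And>x. x \<notin> {a..b} \<Longrightarrow> f x = 0" and t: "t \<notin> {a - b..b - a}"
  shows "corr f f t = 0"
proof -
  have "f x * f (x + t) = 0" for x
    using f[of x] f[of "x + t"] t by (cases "x \<in> {a..b}") auto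
  then show ?thesis unfolding corr_def by (simp only: nn_integral_const mult_zero_left)
qed

section \<open>Lower bound for the supremum of an autoconvolution\<close>

lemma autoconvolution_gt:
  fixes f :: "real \<Rightarrow> ennreal"
  assumes [measurable]: "f \<in> borel_measurable borel"
    and supp: "\<And>x. x \<notin> {0..21} \<Longrightarrow> f x = 0"
    and int: "(\<integral>\<^sup>+x. f x \<partial>lborel) = 1"
  shows "\<exists>t. ennreal (631 / 21000) < conv f f t"
proof (rule ccontr)
  assume "\<not> ?thesis"
  then have le: "conv f f t \<le> ennreal (631 / 21000)" for t
    by (simp add: not_less)
  define M where "M = ennreal (631 / 21000)"
  define \<phi> where "\<phi> = step (entry kernel_weights)"
  define \<psi> where "\<psi> = step (entry dual_weights)"
  have [measurable]: "\<phi> \<in> borel_measurable borel" "\<psi> \<in> borel_measurable borel"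
    by (auto simp: \<phi>_def \<psi>_def)
  define K where "K = corr \<phi> \<phi>"
  have [measurable]: "K \<in> borel_measurable borel" by (simp add: K_def)
  define F where "F x = f x + f (21 - x)" for x
  have [measurable]: "F \<in> borel_measurable borel" by (simp add: F_def[abs_def])
  define X where "X = (\<integral>\<^sup>+t. corr f f t * K t \<partial>lborel)"
  \<comment> \<open>By \<open>nn_integral_conv_square\<close>, \<open>Q\<close> is the integral of
    the square of \<open>conv F \<phi>\<close>.\<close>
  define Q where "Q = (\<integral>\<^sup>+t. corr F F t * K t \<partial>lborel)"
  have w0: "entry kernel_weights i = 0" if "i \<notin> {0..<6}" for i
    using entry_eq_0[of i kernel_weights] that by (simp add: kernel_weights_def)
  have v0: "entry dual_weights i = 0" if "i \<notin> {0..<27}" for i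
    using entry_eq_0[of i dual_weights] that by (simp add: dual_weights_def)

  \<comment> \<open>Integrals of the kernel and the test functions\<close>
  have K1: "(\<integral>\<^sup>+t. K t \<partial>lborel) = 2500"
  proof -
    have "(\<integral>\<^sup>+x. \<phi> x \<partial>lborel) = of_nat 50"
      unfolding \<phi>_def kernel_weights_sum[symmetric] by (rule nn_integral_step) (rule w0)
    then show ?thesis by (simp add: K_def nn_integral_corr)
  qed
  have K2: "(\<integral>\<^sup>+t. (K t)\<^sup>2 \<partial>lborel) = ennreal (1891568 / 3)"
    unfolding K_def \<phi>_def kernel_autocorrelation[symmetric]
  proof (rule nn_integral_corr_step_square[OF w0])
    show "(\<Sum>i\<in>{0..<6}. entry kernel_weights i * entry kernel_weights (i + k)) = 0" if "k \<notin> {- 6<..<6}" for k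
      using that by (intro sum.neutral) (auto intro!: w0)
  qed
  have \<psi>2: "(\<integral>\<^sup>+x. (\<psi> x)\<^sup>2 \<partial>lborel) = 3214751020"
  proof -
    have "(\<integral>\<^sup>+x. (\<psi> x)\<^sup>2 \<partial>lborel) = (\<integral>\<^sup>+x. step (\<lambda>i. (entry dual_weights i)\<^sup>2) x \<partial>lborel)"
      by (simp add: \<psi>_def step_def)
    also have "\<dots> = of_nat 3214751020"
      unfolding dual_weights_squares[symmetric] by (rule nn_integral_step) (simp add: v0)
    finally show ?thesis by simp
  qed
  have F1: "(\<integral>\<^sup>+x. F x \<partial>lborel) = 2"
    unfolding F_def by (simp add: nn_integral_add nn_integral_lborel_reflect int)

  \<comment> \<open>Upper bound for \<open>X\<close>\<close>
  have "(\<integral>\<^sup>+t. (corr f f t)\<^sup>2 \<partial>lborel) = (\<integral>\<^sup>+t. conv f f t * conv f f t \<partial>lborel)"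
    by (simp add: nn_integral_conv_square power2_eq_square)
  \<comment> \<open>One factor is bounded by \<open>M\<close>; the other has integral 1 because
    \<open>f\<close> does.\<close>
  also have "\<dots> \<le> (\<integral>\<^sup>+t. M * conv f f t \<partial>lborel)"
    using le by (intro nn_integral_mono mult_right_mono) (auto simp: M_def)
  also have "\<dots> = M"
    by (simp add: nn_integral_cmult nn_integral_conv int)
  finally have R2: "(\<integral>\<^sup>+t. (corr f f t)\<^sup>2 \<partial>lborel) \<le> M" .

  \<comment> \<open>\<open>1/8800\<close>, \<open>1/59\<close> and, below, \<open>1/2912\<close> approximate the multipliers that give equality in the
      two Cauchy--Schwarz inequalities.\<close>
  have "2 * ennreal (1 / 8800) * X + 2 * ennreal (1 / 59) * 1
     \<le> (\<integral>\<^sup>+t. (corr f f t)\<^sup>2 \<partial>lborel) + (ennreal (1 / 8800))\<^sup>2 * ennreal (1891568 / 3)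
      + 2 * ennreal (1 / 8800) * ennreal (1 / 59) * 2500 + (ennreal (1 / 59))\<^sup>2 * ennreal 42"
    using nn_integral_mult_le_Cauchy[of "corr f f" K "{-21..21}" "ennreal (1 / 8800)" "ennreal (1 / 59)"]
      corr_eq_0[of 0 21 f, OF supp]
    by (simp add: X_def K1 K2 nn_integral_corr int)
  also have "\<dots> \<le> M + (ennreal (1 / 8800))\<^sup>2 * ennreal (1891568 / 3)
      + 2 * ennreal (1 / 8800) * ennreal (1 / 59) * 2500 + (ennreal (1 / 59))\<^sup>2 * ennreal 42"
    by (intro add_mono R2 order_refl)
  finally have upper: "2 * ennreal (1 / 8800) * X + 2 * ennreal (1 / 59) * 1
    \<le> M + (ennreal (1 / 8800))\<^sup>2 * ennreal (1891568 / 3)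
      + 2 * ennreal (1 / 8800) * ennreal (1 / 59) * 2500 + (ennreal (1 / 59))\<^sup>2 * ennreal 42" .

  \<comment> \<open>Lower bound for \<open>X\<close>\<close>
  have "of_nat 551924 \<le> corr \<phi> \<psi> x" if "F x \<noteq> 0" for x
  proof -
    have "x \<in> {0..21}" using that supp[of x] supp[of "21 - x"] by (auto simp: F_def)
    then show ?thesis
      unfolding \<phi>_def \<psi>_def
      by (intro corr_step_ge[OF w0 dual_weights_correlation_ge]) auto
  qed
  then have lower: "2 * ennreal (1 / 2912) * 551924 * 2 \<le> Q + (ennreal (1 / 2912))\<^sup>2 * 3214751020"
    using nn_integral_corr_quadratic_ge[of F \<phi> \<psi> "of_nat 551924" "ennreal (1 / 2912)"]
    by (simp add: F1 \<psi>2 Q_def K_def)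

  have "Q = (\<integral>\<^sup>+t. 2 * (corr f f t * K t) + (conv f f (21 + t) + conv f f (21 - t)) * K t \<partial>lborel)"
    unfolding Q_def F_def corr_symmetrization[OF assms(1)] by (simp add: distrib_right mult.assoc)
  \<comment> \<open>The assumed bound on the autoconvolution enters a second time, now in both mixed
    terms of the symmetrization.\<close>
  also have "\<dots> \<le> (\<integral>\<^sup>+t. 2 * (corr f f t * K t) + (M + M) * K t \<partial>lborel)"
    using le by (intro nn_integral_mono add_mono mult_right_mono) (auto simp: M_def)
  also have "\<dots> = 2 * X + (M + M) * 2500"
    by (simp add: nn_integral_add nn_integral_cmult X_def K1)
  finally have "Q \<le> 2 * X + (M + M) * 2500" .
  with lower have lower': "2 * ennreal (1 / 2912) * 551924 * 2
      \<le> 2 * X + (M + M) * 2500 + (ennreal (1 / 2912))\<^sup>2 * 3214751020"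
    by (meson add_right_mono order_trans)

  show False
  proof (cases X)
    \<comment> \<open>The right side of \<open>upper\<close> is finite, so \<open>X\<close> is a
      real number and the two bounds can be compared by arithmetic.\<close>
    case top
    with upper show False
      by (simp add: M_def ennreal_mult_top top_unique ennreal_mult_eq_top_iff power_eq_top_ennreal)
  next
    case (real x)
    from upper have "2 * (1 / 8800) * x + 2 * (1 / 59) * 1
      \<le> 631 / 21000 + (1 / 8800)\<^sup>2 * (1891568 / 3) + 2 * (1 / 8800) * (1 / 59) * 2500 + (1 / 59)\<^sup>2 * 42"
      using real(1)
      by (simp add: real(2) M_def ennreal_power flip: ennreal_mult ennreal_plus ennreal_numeral ennreal_1)
    moreover from lower' have "2 * (1 / 2912) * 551924 * 2
      \<le> 2 * x + (631 / 21000 + 631 / 21000) * 2500 + (1 / 2912)\<^sup>2 * 3214751020"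
      using real(1)
      by (simp add: real(2) M_def ennreal_power flip: ennreal_mult ennreal_plus ennreal_numeral ennreal_1)
    \<comment> \<open>The first inequality gives \<open>x < 114.35\<close>, the second
      \<open>x > 114.39\<close>.\<close>
    ultimately show False by (simp add: power2_eq_square)
  qed
qed

subsection \<open>Symmetric subsets\<close>

text \<open>For the normalized indicator \<open>f\<close> of \<open>B\<close> stretched to [0, 21],
  \<open>conv f f t\<close> is the measure of the points \<open>x\<close> of \<open>B\<close> with
  \<open>t / 21 - x\<close> in \<open>B\<close>, divided by \<open>21 * \<epsilon>\<^sup>2\<close>.
  The threshold 631/21000 thus becomes \<open>0.631 * \<epsilon>\<^sup>2\<close>.\<close>

lemma exists_large_self_intersection:
  fixes B :: "real set"
  assumes B [measurable]: "B \<in> sets borel" and sub: "B \<subseteq> {0..1}" and pos: "measure lborel B > 0"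
  shows "\<exists>c. 0.631 * (measure lborel B)\<^sup>2 \<le> measure lborel {x \<in> B. c - x \<in> B}"
proof (rule ccontr)
  define \<epsilon> where "\<epsilon> = measure lborel B"
  assume "\<not> ?thesis"
  then have small: "measure lborel {x \<in> B. c - x \<in> B} \<le> 0.631 * \<epsilon>\<^sup>2" for c
    by (simp add: \<epsilon>_def not_le less_imp_le)
  have fin: "emeasure lborel C = ennreal (measure lborel C)" if "C \<subseteq> B" for C
    using emeasure_bounded_finite[of C] that sub bounded_subset[of "{0..1::real}" C]
    by (intro emeasure_eq_ennreal_measure) auto
  define f where "f x = ennreal (1 / (21 * \<epsilon>)) * indicator B (x / 21)" for x :: real
  have [measurable]: "f \<in> borel_measurable borel" unfolding f_def[abs_def] by measurable
  have "\<exists>t. ennreal (631 / 21000) < conv f f t"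
  proof (rule autoconvolution_gt)
    show "f x = 0" if "x \<notin> {0..21}" for x
      using that sub by (auto simp: f_def indicator_def)
    have "(\<integral>\<^sup>+x. f x \<partial>lborel) = 21 * (\<integral>\<^sup>+x. f (21 * x) \<partial>lborel)"
      using nn_integral_real_affine[of f 21 0] by simp
    also have "\<dots> = 21 * (ennreal (1 / (21 * \<epsilon>)) * ennreal \<epsilon>)"
      using fin[of B] by (simp add: f_def nn_integral_cmult \<epsilon>_def)
    also have "\<dots> = 1"
      using pos by (simp add: \<epsilon>_def flip: ennreal_mult ennreal_numeral)
    finally show "(\<integral>\<^sup>+x. f x \<partial>lborel) = 1" .
  qed simp
  moreover have "conv f f t \<le> ennreal (631 / 21000)" for t
  proof -
    have "(\<integral>\<^sup>+x. f (21 * x) * f (t - 21 * x) \<partial>lborel)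
      = (\<integral>\<^sup>+x. (ennreal (1 / (21 * \<epsilon>)))\<^sup>2 * indicator {x \<in> B. t / 21 - x \<in> B} x \<partial>lborel)"
      by (intro nn_integral_cong) (auto simp: f_def indicator_def power2_eq_square diff_divide_distrib)
    also have "\<dots> = (ennreal (1 / (21 * \<epsilon>)))\<^sup>2 * ennreal (measure lborel {x \<in> B. t / 21 - x \<in> B})"
      using fin[of "{x \<in> B. t / 21 - x \<in> B}"] by (simp add: nn_integral_cmult_indicator)
    also have "\<dots> \<le> (ennreal (1 / (21 * \<epsilon>)))\<^sup>2 * ennreal (0.631 * \<epsilon>\<^sup>2)"
      by (intro mult_left_mono ennreal_leI small) auto
    also have "\<dots> = ennreal ((1 / (21 * \<epsilon>))\<^sup>2 * (0.631 * \<epsilon>\<^sup>2))"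
      using pos by (simp add: \<epsilon>_def ennreal_power flip: ennreal_mult)
    also have "(1 / (21 * \<epsilon>))\<^sup>2 * (0.631 * \<epsilon>\<^sup>2) = 631 / 441000"
      using pos by (simp add: \<epsilon>_def power2_eq_square field_simps)
    finally have "21 * (\<integral>\<^sup>+x. f (21 * x) * f (t - 21 * x) \<partial>lborel) \<le> 21 * ennreal (631 / 441000)"
      by (rule mult_left_mono) simp
    moreover have "conv f f t = 21 * (\<integral>\<^sup>+x. f (21 * x) * f (t - 21 * x) \<partial>lborel)"
      unfolding conv_def using nn_integral_real_affine[of "\<lambda>x. f x * f (t - x)" 21 0] by simp
    moreover have "21 * ennreal (631 / 441000) = ennreal (631 / 21000)"
      by (simp flip: ennreal_mult ennreal_numeral)
    ultimately show ?thesis by (simp only:)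
  qed
  ultimately show False by (meson not_less)
qed

text \<open>Intersecting with an interval centred at \<open>c / 2\<close> preserves the symmetry,
  and the measure of the intersection varies continuously with the radius, so the intermediate value
  theorem supplies the right one.\<close>

lemma centrally_symmetric_subset_of_measure:
  fixes T :: "real set"
  assumes [measurable]: "T \<in> sets borel" and "bounded T" and sym: "\<And>x. x \<in> T \<Longrightarrow> c - x \<in> T"
    and m: "0 \<le> m" "m \<le> measure lborel T"
  obtains S where "S \<subseteq> T" "S \<in> sets borel" "centrally_symmetric S" "measure lborel S = m"
proof -
  define I where "I r = {c / 2 - r..c / 2 + r}" for r
  define h where "h r = measure lborel (T \<inter> I r)" for r
  obtain R where R: "R \<ge> 0" "T \<subseteq> I R"
  proof -
    obtain a where "\<forall>x\<in>T. dist (c / 2) x \<le> a"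
      using \<open>bounded T\<close> unfolding bounded_any_center[of _ "c / 2"] by blast
    \<comment> \<open>For empty \<open>T\<close> the bound \<open>a\<close> may be negative; the
      maximum keeps the radius nonnegative.\<close>
    then have "x \<in> I (max a 0)" if "x \<in> T" for x
      using that unfolding I_def dist_real_def atLeastAtMost_iff by (smt (verit))
    then have "T \<subseteq> I (max a 0)" by blast
    then show ?thesis using that[of "max a 0"] by simp
  qed
  \<comment> \<open>Passing from radius \<open>r\<close> to \<open>s\<close> adds at most the set
    \<open>I s - I r\<close>, of measure \<open>2 * (s - r)\<close>.\<close>
  have mono: "h r \<le> h s \<and> h s \<le> h r + 2 * (s - r)" if "0 \<le> r" "r \<le> s" for r s
  proof -
    have fm: "C \<in> fmeasurable lborel" if "C \<in> sets borel" "C \<subseteq> I s" for C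
    proof -
      have "I s \<in> fmeasurable lborel"
        by (rule fmeasurableI) (simp_all add: I_def emeasure_lborel_Icc_eq)
      then show ?thesis using that by (rule_tac fmeasurableI2) auto
    qed
    have rs: "I r \<subseteq> I s" using that by (auto simp: I_def)
    have "h r \<le> h s"
      unfolding h_def using rs by (intro measure_mono_fmeasurable fm) (auto simp: I_def)
    moreover have "h s \<le> measure lborel ((T \<inter> I r) \<union> (I s - I r))"
      unfolding h_def using rs by (intro measure_mono_fmeasurable fm) (auto simp: I_def)
    moreover have "\<dots> \<le> h r + measure lborel (I s - I r)"
      unfolding h_def by (intro measure_Un_le) (auto simp: I_def)
    moreover have "measure lborel (I s - I r) = measure lborel (I s) - measure lborel (I r)"
      using rs by (intro measure_Diff) (auto simp: I_def emeasure_lborel_Icc_eq)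
    ultimately show ?thesis using that by (simp add: I_def)
  qed
  have "2-lipschitz_on {0..R} h"
  proof (rule lipschitz_onI)
    fix r s :: real assume "r \<in> {0..R}" "s \<in> {0..R}"
    then show "dist (h r) (h s) \<le> 2 * dist r s"
      using mono[of r s] mono[of s r] by (cases "r \<le> s") (simp_all add: dist_real_def abs_if)
  qed simp
  then have "continuous_on {0..R} h" by (rule lipschitz_on_continuous_on)
  moreover have "h 0 \<le> m"
  proof -
    have "h 0 \<le> measure lborel {c / 2}"
      unfolding h_def I_def by (intro measure_mono_fmeasurable) (auto intro!: fmeasurableI)
    then show ?thesis using m by simp
  qed
  moreover have "m \<le> h R"
    using m R by (simp add: h_def Int_absorb2)
  ultimately obtain r where r: "h r = m"
    using IVT'[of h 0 m R] R(1) by blast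
  show ?thesis
  proof
    have *: "c - x \<in> T \<inter> I r" if "x \<in> T \<inter> I r" for x
      using that sym[of x] by (auto simp: I_def field_simps)
    show "centrally_symmetric (T \<inter> I r)"
      unfolding centrally_symmetric_def
    proof (intro exI[of _ c] equalityI subsetI)
      fix x assume "x \<in> T \<inter> I r"
      from *[OF this] show "x \<in> (\<lambda>s. c - s) ` (T \<inter> I r)"
        by (intro image_eqI[of _ _ "c - x"]) auto
    qed (use * in blast)
  qed (use r in \<open>auto simp: h_def I_def\<close>)
qed

section \<open>From Borel sets to Lebesgue measurable sets\<close>

theorem corollary1p2:
  fixes \<epsilon> :: real and A :: "real set"
  assumes "\<epsilon> \<ge> 0"
    and "A \<in> sets lebesgue"
    and "A \<subseteq> {0..1}"
    and "measure lebesgue A = \<epsilon>"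
  shows "\<exists>S. S \<subseteq> A \<and> S \<in> sets lebesgue \<and> centrally_symmetric S \<and>
             measure lebesgue S = 0.631 * \<epsilon>\<^sup>2"
proof (cases "\<epsilon> = 0")
  case True
  \<comment> \<open>No normalization by \<open>1 / \<epsilon>\<close> is possible here; the empty
    set serves.\<close>
  then show ?thesis by (intro exI[of _ "{}"]) (auto simp: centrally_symmetric_def)
next
  case False
  \<comment> \<open>The main part is a Borel subset of \<open>A\<close> with the same measure, which
    brings the problem into \<open>lborel\<close>.\<close>
  define B where "B = main_part lborel A"
  have BA: "B \<subseteq> A"
    unfolding B_def by (subst (2) main_part_null_part_Un[OF assms(2), symmetric]) (rule Un_upper1)
  have B [measurable]: "B \<in> sets borel"
    using main_part_sets[OF assms(2)] by (simp add: B_def)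
  have measB: "measure lborel B = \<epsilon>"
    unfolding assms(4)[symmetric] B_def measure_def by (simp only: emeasure_completion[OF assms(2)])
  have B01: "B \<subseteq> {0..1}" using BA assms(3) by (rule order_trans)
  have "0 < measure lborel B" using measB assms(1) False by simp
  from exists_large_self_intersection[OF B B01 this]
  obtain c where c: "0.631 * \<epsilon>\<^sup>2 \<le> measure lborel {x \<in> B. c - x \<in> B}"
    unfolding measB by blast
  obtain S where S: "S \<subseteq> {x \<in> B. c - x \<in> B}" "S \<in> sets borel" "centrally_symmetric S"
      "measure lborel S = 0.631 * \<epsilon>\<^sup>2"
  proof (rule centrally_symmetric_subset_of_measure[of "{x \<in> B. c - x \<in> B}" c "0.631 * \<epsilon>\<^sup>2"])
    show "{x \<in> B. c - x \<in> B} \<in> sets borel" by measurable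
    show "bounded {x \<in> B. c - x \<in> B}"
      by (rule bounded_subset[OF bounded_closed_interval]) (use B01 in blast)
    show "0 \<le> 0.631 * \<epsilon>\<^sup>2" by simp
  qed (use c in simp_all)
  have "S \<subseteq> A" using S(1) BA by blast
  moreover have "S \<in> sets lebesgue" using S(2) by simp
  moreover have "measure lebesgue S = 0.631 * \<epsilon>\<^sup>2" using S(2,4) by (simp add: measure_completion)
  ultimately show ?thesis using S(3) by blast
qed

end
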